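(* Let $\phi:[0,+\infty)\to[0,+\infty)$ be any convex function such that $\phi(t)=0$ if and only if $t=0$. Then the $\phi$-rigidity property holds in $\mathbb{R}^2$.
   Context: Points of $\mathbb{R}^n$ are written $x=(x_1,\dots,x_n)$. Let $\phi:[0,+\infty)\to[0,+\infty)$ be a convex function such that $\phi(t)=0$ if and only if $t=0$. We say that the $\phi$-rigidity property holds in $\mathbb{R}^n$ if, for any vector field $\eta=(\eta_1,\dots,\eta_n)\in L^\infty(\mathbb{R}^n;\mathbb{R}^n)$ such that (i) $\eta=0$ (almost everywhere) on $\{x\in\mathbb{R}^n: x_n<0\}$; (ii) $\operatorname{div}\eta=0$ on $\mathbb{R}^n$ in the distributional sense; (iii) $\eta_n\ge\phi(|\eta|)$ almost everywhere on $\mathbb{R}^n$; one has $\eta=0$ almost everywhere on $\mathbb{R}^n$. *)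

theory Defs
  imports "HOL-Analysis.Analysis"
begin

definition partial_deriv :: "'n::finite \<Rightarrow> (real ^ 'n \<Rightarrow> real) \<Rightarrow> real ^ 'n \<Rightarrow> real" where
  "partial_deriv i f x = frechet_derivative f (at x) (axis i 1)"

primrec Ck :: "nat \<Rightarrow> (real ^ 'n::finite \<Rightarrow> real) \<Rightarrow> bool" where
  "Ck 0 f \<longleftrightarrow> continuous_on UNIV f"
| "Ck (Suc m) f \<longleftrightarrow> f differentiable_on UNIV \<and> (\<forall>i. Ck m (partial_deriv i f))"

definition test_function :: "(real ^ 'n::finite \<Rightarrow> real) \<Rightarrow> bool" where
  "test_function \<psi> \<longleftrightarrow> (\<forall>m. Ck m \<psi>) \<and> compact (closure {x. \<psi> x \<noteq> 0})"

definition L_infinity :: "(real ^ 'n::finite \<Rightarrow> real ^ 'n) \<Rightarrow> bool" where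
  "L_infinity \<eta> \<longleftrightarrow>
     \<eta> \<in> borel_measurable lebesgue \<and> (\<exists>C. AE x in lebesgue. norm (\<eta> x) \<le> C)"

text \<open>
  For fields in \<open>L_infinity\<close> the integrand below is bounded with compact support, hence
  integrable, so the convention that non-integrable functions have integral \<open>0\<close> plays no role.
\<close>

definition distributional_div_zero :: "(real ^ 'n::finite \<Rightarrow> real ^ 'n) \<Rightarrow> bool" where
  "distributional_div_zero \<eta> \<longleftrightarrow>
     (\<forall>\<psi>. test_function \<psi> \<longrightarrow>
        (LINT x|lebesgue. (\<Sum>i\<in>UNIV. \<eta> x $ i * partial_deriv i \<psi> x)) = 0)"

text \<open>
  The index type \<open>'n\<close> carries no distinguished order, so the index \<open>l\<close> of the last coordinate
  is a parameter.  On \<open>real ^ 2\<close> it is the index \<open>2\<close>: the two coordinates are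
  \<open>x $ 1\<close> and \<open>x $ 2\<close> (in the type \<open>2\<close>, \<open>2 = 0\<close>, so \<open>2\<close> is not the greatest element there).
\<close>

definition phi_rigidity :: "'n::finite \<Rightarrow> (real \<Rightarrow> real) \<Rightarrow> bool" where
  "phi_rigidity l \<phi> \<longleftrightarrow>
     (\<forall>\<eta> :: real ^ 'n \<Rightarrow> real ^ 'n.
        L_infinity \<eta> \<longrightarrow>
        (AE x in lebesgue. x $ l < 0 \<longrightarrow> \<eta> x = 0) \<longrightarrow>
        distributional_div_zero \<eta> \<longrightarrow>
        (AE x in lebesgue. \<eta> x $ l \<ge> \<phi> (norm (\<eta> x))) \<longrightarrow>
        (AE x in lebesgue. \<eta> x = 0))"

end

theory Submission imports Defs
begin

text \<open>
  Test \<open>div \<eta> = 0\<close> against \<open>F (x\<^sub>1 / n) G (x\<^sub>2)\<close>, where \<open>G \<ge> 0\<close> is a bump with \<open>- G' \<ge> c G\<close> on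
  \<open>[0, \<infinity>)\<close>.  Writing \<open>W r\<close> for the integral of \<open>\<eta>\<^sub>2 G\<close> over \<open>\<bar>x\<^sub>1\<bar> \<le> r\<close>, the second term controls
  \<open>W (n/2)\<close> from above by the integral of \<open>\<bar>\<eta>\<^sub>1\<bar> G / n\<close> over \<open>\<bar>x\<^sub>1\<bar> \<le> n\<close>.  Convexity of \<open>\<phi>\<close> gives
  \<open>\<bar>\<eta>\<bar> \<le> \<delta> + K\<^sub>\<delta> \<eta>\<^sub>2\<close> for every \<open>\<delta> > 0\<close>, hence \<open>W (n/2) \<le> B (\<delta> + K\<^sub>\<delta> W n / n)\<close>.  Since \<open>\<eta>\<close> is bounded,
  \<open>W n = O(n)\<close>; so \<open>W\<close> is bounded, and then \<open>n \<rightarrow> \<infinity>\<close> followed by \<open>\<delta> \<rightarrow> 0\<close> gives \<open>W = 0\<close>.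
\<close>

section \<open>Flat functions on the line: \<open>p (1 / t) * exp (- (1 / t))\<close>, extended by
  zero to \<open>t <= 0\<close>\<close>

definition flat_exp :: "real poly \<Rightarrow> real \<Rightarrow> real" where
  "flat_exp p t = (if t > 0 then poly p (1 / t) * exp (- (1 / t)) else 0)"

text \<open>With \<open>s = 1 / t\<close>, differentiating \<open>poly p s * exp (- s)\<close> in
  \<open>t\<close> gives the factor \<open>s^2\<close> times \<open>p - p'\<close>. The family is
  therefore closed under differentiation, and smoothness follows by induction over all polynomials
  at once.\<close>

definition flat_exp_deriv :: "real poly \<Rightarrow> real poly" where
  "flat_exp_deriv p = monom 1 2 * (p - pderiv p)"

lemma poly_times_exp_minus_tendsto_0:
  "((\<lambda>s. poly p s * exp (- s)) \<longlongrightarrow> (0 :: real)) at_top"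
proof -
  have "((\<lambda>s. \<Sum>i\<le>degree p. coeff p i * (s ^ i / exp s)) \<longlongrightarrow> (\<Sum>i\<le>degree p. coeff p i * 0)) at_top"
    by (intro tendsto_intros tendsto_power_div_exp_0)
  then show ?thesis
    by (simp add: poly_altdef sum_distrib_right exp_minus divide_inverse mult.assoc)
qed

lemma flat_exp_right_limit: "((\<lambda>t. poly p (1 / t) * exp (- (1 / t))) \<longlongrightarrow> 0) (at_right (0::real))"
  using filterlim_compose[OF poly_times_exp_minus_tendsto_0 filterlim_inverse_at_top_right, of p]
  by (simp add: inverse_eq_divide)

lemma flat_exp_has_derivative_pos:
  assumes "t > 0"
  shows "(flat_exp p has_real_derivative flat_exp (flat_exp_deriv p) t) (at t)"
proof -
  have "((\<lambda>t. poly p (1 / t) * exp (- (1 / t))) has_real_derivative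
      flat_exp (flat_exp_deriv p) t) (at t)"
    using assms
    by (auto intro!: derivative_eq_intros DERIV_chain2[OF poly_DERIV]
        simp: flat_exp_def flat_exp_deriv_def poly_monom power2_eq_square algebra_simps divide_simps)
  then show ?thesis
  proof (rule has_field_derivative_transform_within_open)
    show "open {(0::real)<..}" by simp
  qed (use assms in \<open>auto simp: flat_exp_def\<close>)
qed

lemma flat_exp_has_derivative_neg:
  assumes "t < 0"
  shows "(flat_exp p has_real_derivative flat_exp (flat_exp_deriv p) t) (at t)"
proof -
  have "((\<lambda>_. 0) has_real_derivative flat_exp (flat_exp_deriv p) t) (at t)"
    using assms by (simp add: flat_exp_def)
  then show ?thesis
  proof (rule has_field_derivative_transform_within_open)
    show "open {..<0::real}" by simp
  qed (use assms in \<open>auto simp: flat_exp_def\<close>)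
qed

lemma flat_exp_has_derivative_0:
  "(flat_exp p has_real_derivative flat_exp (flat_exp_deriv p) 0) (at 0)"
proof -
  \<comment> \<open>Dividing by \<open>y\<close> multiplies the polynomial by its variable, so the
    right difference quotient at 0 is again a flat function, with limit 0.\<close>
  have "((\<lambda>y. flat_exp p y / y) \<longlongrightarrow> 0) (at_right 0)"
    by (rule Lim_transform_eventually[OF flat_exp_right_limit[of "monom 1 1 * p"]])
      (auto simp: eventually_at_filter flat_exp_def poly_monom field_simps)
  moreover have "((\<lambda>y. flat_exp p y / y) \<longlongrightarrow> 0) (at_left 0)"
    by (rule Lim_transform_eventually[OF tendsto_const])
      (auto simp: eventually_at_filter flat_exp_def)
  ultimately have "((\<lambda>y. flat_exp p y / y) \<longlongrightarrow> 0) (at 0)"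
    by (simp add: filterlim_split_at)
  then show ?thesis
    by (simp add: has_field_derivative_iff flat_exp_def)
qed

lemma flat_exp_has_derivative:
  "(flat_exp p has_real_derivative flat_exp (flat_exp_deriv p) t) (at t)"
  using flat_exp_has_derivative_pos flat_exp_has_derivative_neg flat_exp_has_derivative_0
  by (metis linorder_less_linear)

section \<open>Partial derivatives and closure properties of \<open>Ck\<close>\<close>

lemma partial_deriv_eqI:
  "(f has_derivative f') (at x) \<Longrightarrow> partial_deriv i f x = f' (axis i 1)"
  unfolding partial_deriv_def using frechet_derivative_at by metis

lemma Ck_Suc_imp: "Ck (Suc m) f \<Longrightarrow> Ck m f"
  by (induction m arbitrary: f) (auto simp: differentiable_imp_continuous_on)

lemma partial_deriv_add:
  assumes "f differentiable (at x)" "g differentiable (at x)"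
  shows "partial_deriv i (\<lambda>x. f x + g x) x = partial_deriv i f x + partial_deriv i g x"
  using assms[unfolded frechet_derivative_works] unfolding partial_deriv_def[of _ f] partial_deriv_def[of _ g]
  by (intro partial_deriv_eqI[THEN trans]) (auto intro!: derivative_eq_intros)

lemma partial_deriv_mult:
  assumes "f differentiable (at x)" "g differentiable (at x)"
  shows "partial_deriv i (\<lambda>x. f x * g x) x = f x * partial_deriv i g x + partial_deriv i f x * g x"
  using assms[unfolded frechet_derivative_works] unfolding partial_deriv_def[of _ f] partial_deriv_def[of _ g]
  by (intro partial_deriv_eqI[THEN trans]) (auto intro!: derivative_eq_intros)

lemma Ck_add: "Ck m f \<Longrightarrow> Ck m g \<Longrightarrow> Ck m (\<lambda>x. f x + g x)"
proof (induction m arbitrary: f g)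
  case 0
  then show ?case by (auto intro: continuous_intros)
next
  case (Suc m)
  then have "f differentiable (at x)" "g differentiable (at x)" for x
    by (auto simp: differentiable_on_def)
  then have "partial_deriv i (\<lambda>x. f x + g x) = (\<lambda>x. partial_deriv i f x + partial_deriv i g x)" for i
    by (auto simp: partial_deriv_add)
  with Suc show ?case by (auto intro: differentiable_add simp: differentiable_on_def)
qed

lemma Ck_mult: "Ck m f \<Longrightarrow> Ck m g \<Longrightarrow> Ck m (\<lambda>x. f x * g x)"
proof (induction m arbitrary: f g)
  case 0
  then show ?case by (auto intro: continuous_intros)
next
  case (Suc m)
  then have "f differentiable (at x)" "g differentiable (at x)" for x
    by (auto simp: differentiable_on_def)
  then have "partial_deriv i (\<lambda>x. f x * g x) = (\<lambda>x. f x * partial_deriv i g x + partial_deriv i f x * g x)" for i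
    by (auto simp: partial_deriv_mult)
  \<comment> \<open>The product rule leaves one factor undifferentiated in each term, so the
    induction hypothesis also needs \<open>f\<close> and \<open>g\<close> themselves at level
    \<open>m\<close>.\<close>
  moreover have "Ck m f" "Ck m g"
    using Suc.prems by (blast dest: Ck_Suc_imp)+
  ultimately show ?case
    using Suc by (auto intro: differentiable_mult Ck_add simp: differentiable_on_def)
qed

lemma flat_exp_comp_has_derivative:
  "((\<lambda>x. flat_exp p (a * x $ j + b)) has_derivative
    (\<lambda>v. flat_exp (flat_exp_deriv p) (a * x $ j + b) * (a * v $ j))) (at x)"
  by (rule has_derivative_eq_rhs[OF has_derivative_compose[OF _ flat_exp_has_derivative[unfolded has_field_derivative_def]]])
    (auto intro!: derivative_eq_intros bounded_linear.has_derivative[OF bounded_linear_vec_nth])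

lemma flat_exp_comp_differentiable:
  "(\<lambda>x. flat_exp p (a * x $ j + b)) differentiable (at x)"
  using flat_exp_comp_has_derivative differentiable_def by blast

lemma partial_deriv_flat_exp_comp:
  "partial_deriv i (\<lambda>x. flat_exp p (a * x $ j + b)) x =
    (if i = j then a * flat_exp (flat_exp_deriv p) (a * x $ j + b) else 0)"
  by (subst partial_deriv_eqI[OF flat_exp_comp_has_derivative]) (auto simp: axis_def)

lemma Ck_flat_exp_comp: "Ck m (\<lambda>x. flat_exp p (a * x $ j + b))"
proof (induction m arbitrary: p)
  case 0
  have "continuous (at x) (\<lambda>x. flat_exp p (a * x $ j + b))" for x
    by (rule differentiable_imp_continuous_within[OF flat_exp_comp_differentiable])
  then show ?case by (simp add: continuous_at_imp_continuous_on)
next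
  case (Suc m)
  \<comment> \<open>The zero derivative for \<open>i \<noteq> j\<close> is written as the flat
    function of the zero polynomial, so that the induction hypothesis covers both cases.\<close>
  have "partial_deriv i (\<lambda>x. flat_exp p (a * x $ j + b)) =
     (\<lambda>x. flat_exp (if i = j then smult a (flat_exp_deriv p) else 0) (a * x $ j + b))" for i
    by (simp add: fun_eq_iff partial_deriv_flat_exp_comp) (simp add: flat_exp_def)
  then show ?case
    using Suc by (simp add: differentiable_on_def flat_exp_comp_differentiable differentiable_at_withinI)
qed

section \<open>One-dimensional bumps, positive exactly on \<open>(-a, b)\<close>, and their
  derivatives\<close>

definition bump :: "real \<Rightarrow> real \<Rightarrow> real \<Rightarrow> real" where
  "bump a b t = flat_exp 1 (t + a) * flat_exp 1 (b - t)"

definition bump_deriv :: "real \<Rightarrow> real \<Rightarrow> real \<Rightarrow> real" where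
  "bump_deriv a b t = flat_exp (flat_exp_deriv 1) (t + a) * flat_exp 1 (b - t)
     - flat_exp 1 (t + a) * flat_exp (flat_exp_deriv 1) (b - t)"

text \<open>The reflection in \<open>b - t\<close> is absorbed into the coefficient
  \<open>- c\<close>, so both factors are flat functions of an affine function of one
  coordinate.\<close>

lemma bump_scaled_eq:
  "bump a b (c * x $ j) = flat_exp 1 (c * x $ j + a) * flat_exp 1 ((- c) * x $ j + b)"
  by (simp add: bump_def add.commute)

lemma bump_scaled_differentiable: "(\<lambda>x. bump a b (c * x $ j)) differentiable (at x)"
  unfolding bump_scaled_eq by (intro differentiable_mult flat_exp_comp_differentiable)

lemma Ck_bump_scaled: "Ck m (\<lambda>x. bump a b (c * x $ j))"
  unfolding bump_scaled_eq by (intro Ck_mult Ck_flat_exp_comp)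

lemma partial_deriv_bump_scaled:
  "partial_deriv i (\<lambda>x. bump a b (c * x $ j)) x = (if i = j then c * bump_deriv a b (c * x $ j) else 0)"
  unfolding bump_scaled_eq
  by (simp only: partial_deriv_mult[OF flat_exp_comp_differentiable flat_exp_comp_differentiable]
      partial_deriv_flat_exp_comp) (simp add: bump_deriv_def algebra_simps)

lemma flat_exp_1_bounds: "0 \<le> flat_exp 1 t" "flat_exp 1 t \<le> 1"
  by (auto simp: flat_exp_def)

lemma flat_exp_deriv_1: "t > 0 \<Longrightarrow> flat_exp (flat_exp_deriv 1) t = flat_exp 1 t / t\<^sup>2"
  by (simp add: flat_exp_def flat_exp_deriv_def poly_monom power_divide)

lemma flat_exp_deriv_1_bounds:
  "0 \<le> flat_exp (flat_exp_deriv 1) t" "flat_exp (flat_exp_deriv 1) t \<le> 2"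
proof -
  \<comment> \<open>For \<open>s = 1 / t\<close> the derivative is \<open>s^2 * exp (- s)\<close>,
    and \<open>exp s >= s^2 / 2\<close> yields the constant 2.\<close>
  have "s\<^sup>2 * exp (- s) \<le> 2" if "s > 0" for s :: real
    using exp_lower_Taylor_quadratic[of s] that by (simp add: exp_minus field_simps)
  from this[of "1 / t"] show "flat_exp (flat_exp_deriv 1) t \<le> 2"
    by (simp add: flat_exp_def flat_exp_deriv_def poly_monom)
qed (simp add: flat_exp_def flat_exp_deriv_def poly_monom)

lemma bump_bounds: "0 \<le> bump a b t" "bump a b t \<le> 1"
  by (auto simp: bump_def flat_exp_1_bounds intro: mult_le_one)

text \<open>Both terms of the derivative lie in \<open>[0, 2]\<close>, so their difference has
  absolute value at most 2.\<close>

lemma bump_deriv_bound: "\<bar>bump_deriv a b t\<bar> \<le> 2"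
proof -
  have *: "0 \<le> flat_exp (flat_exp_deriv 1) u * flat_exp 1 v"
    "flat_exp (flat_exp_deriv 1) u * flat_exp 1 v \<le> 2" for u v
    using mult_mono[of "flat_exp (flat_exp_deriv 1) u" 2 "flat_exp 1 v" 1]
    by (auto simp: flat_exp_1_bounds flat_exp_deriv_1_bounds)
  show ?thesis
    using *[of "t + a" "b - t"] *[of "b - t" "t + a"] unfolding bump_deriv_def
    by (simp add: mult.commute abs_le_iff)
qed

lemma bump_eq_0: "t \<le> - a \<or> b \<le> t \<Longrightarrow> bump a b t = 0"
  and bump_deriv_eq_0: "t \<le> - a \<or> b \<le> t \<Longrightarrow> bump_deriv a b t = 0"
  by (auto simp: bump_def bump_deriv_def flat_exp_def)

lemma bump_pos: "- a < t \<Longrightarrow> t < b \<Longrightarrow> 0 < bump a b t"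
  by (simp add: bump_def flat_exp_def)

text \<open>Each of the two exponents is at least -2 at distance at least 1/2 from the endpoints;
  together they give \<open>exp (-4)\<close>.\<close>

lemma bump_ge_half:
  assumes "\<bar>s\<bar> \<le> 1 / 2"
  shows "exp (-4) \<le> bump 1 1 s"
proof -
  have "1 / (s + 1) \<le> 2" "1 / (1 - s) \<le> 2"
    using assms by (auto simp: field_simps abs_le_iff)
  then have "exp (-4) \<le> exp (- (1 / (s + 1)) + - (1 / (1 - s)))"
    by simp
  also have "\<dots> = bump 1 1 s"
    using assms unfolding exp_add by (auto simp: bump_def flat_exp_def abs_le_iff)
  finally show ?thesis .
qed

text \<open>
  The lopsided support \<open>[-2h, h]\<close> makes the factor vanishing at \<open>h\<close> dominate the logarithmic
  derivative on all of \<open>[0, h)\<close>.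
\<close>
lemma bump_le_neg_deriv:
  assumes "h > 0" "t \<ge> 0"
  shows "3 / (4 * h\<^sup>2) * bump (2 * h) h t \<le> - bump_deriv (2 * h) h t"
proof (cases "t < h")
  case False
  then show ?thesis by (simp add: bump_eq_0 bump_deriv_eq_0)
next
  case True
  \<comment> \<open>On \<open>[0, h)\<close> the logarithmic derivative is
    \<open>1 / (t + 2 * h)^2 - 1 / (h - t)^2\<close>. Its negative is smallest at
    \<open>t = 0\<close>, where it equals \<open>1 / h^2 - 1 / (4 * h^2)\<close>, the constant
    claimed.\<close>
  have "1 / h\<^sup>2 \<le> 1 / (h - t)\<^sup>2"
    using assms True by (intro divide_left_mono power_mono zero_less_power mult_pos_pos) auto
  moreover have "1 / (t + 2 * h)\<^sup>2 \<le> 1 / (2 * h)\<^sup>2"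
    using assms by (intro divide_left_mono power_mono zero_less_power mult_pos_pos) auto
  ultimately have "3 / (4 * h\<^sup>2) \<le> 1 / (h - t)\<^sup>2 - 1 / (t + 2 * h)\<^sup>2"
    by (simp add: power_mult_distrib)
  then have "3 / (4 * h\<^sup>2) * bump (2 * h) h t
      \<le> (1 / (h - t)\<^sup>2 - 1 / (t + 2 * h)\<^sup>2) * bump (2 * h) h t"
    by (intro mult_right_mono bump_bounds)
  also have "\<dots> = - bump_deriv (2 * h) h t"
    using assms True by (simp add: bump_deriv_def bump_def flat_exp_deriv_1 algebra_simps)
  finally show ?thesis .
qed

text \<open>The factor \<open>1 *\<close> keeps the second bump in scaled form, so the lemmas on
  scaled bumps apply to both coordinates.\<close>

lemma test_function_bump_product:
  assumes "c \<noteq> 0"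
  shows "test_function (\<lambda>x :: real^2. bump a b (c * x $ 1) * bump a' b' (1 * x $ 2))"
  unfolding test_function_def
proof (intro conjI allI)
  show "Ck m (\<lambda>x :: real^2. bump a b (c * x $ 1) * bump a' b' (1 * x $ 2))" for m
    by (intro Ck_mult Ck_bump_scaled)
  let ?r = "(\<bar>a\<bar> + \<bar>b\<bar>) / \<bar>c\<bar>"
  have "{x :: real^2. bump a b (c * x $ 1) * bump a' b' (1 * x $ 2) \<noteq> 0}
     \<subseteq> cbox (vector [- ?r, - a']) (vector [?r, b'])"
  proof
    fix x :: "real^2"
    assume "x \<in> {x. bump a b (c * x $ 1) * bump a' b' (1 * x $ 2) \<noteq> 0}"
    then have "- a < c * x $ 1" "c * x $ 1 < b" "- a' < x $ 2" "x $ 2 < b'"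
      using bump_eq_0[of "c * x $ 1" a b] bump_eq_0[of "x $ 2" a' b'] by fastforce+
    moreover from this have "\<bar>x $ 1\<bar> \<le> ?r"
      using assms by (simp add: pos_le_divide_eq abs_mult[symmetric] mult.commute)
    ultimately show "x \<in> cbox (vector [- ?r, - a']) (vector [?r, b'])"
      by (auto simp: mem_box_cart forall_2 abs_le_iff)
  qed
  then show "compact (closure {x :: real^2. bump a b (c * x $ 1) * bump a' b' (1 * x $ 2) \<noteq> 0})"
    using bounded_subset[OF bounded_cbox] compact_closure by blast
qed

lemma partial_derivs_bump_product:
  fixes x :: "real^2"
  shows "partial_deriv 1 (\<lambda>x. bump a b (c * x $ 1) * bump a' b' (1 * x $ 2)) x
      = c * bump_deriv a b (c * x $ 1) * bump a' b' (x $ 2)"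
    and "partial_deriv 2 (\<lambda>x. bump a b (c * x $ 1) * bump a' b' (1 * x $ 2)) x
      = bump a b (c * x $ 1) * bump_deriv a' b' (x $ 2)"
  by (simp_all only: partial_deriv_mult[OF bump_scaled_differentiable bump_scaled_differentiable]
      partial_deriv_bump_scaled) simp_all

section \<open>Measurability, integrability and the weights\<close>

lemma integrable_indicator_cbox:
  "integrable lebesgue (indicator (cbox u v) :: 'a::euclidean_space \<Rightarrow> real)"
  using emeasure_lborel_cbox_finite[of u v]
  by (intro integrable_real_indicator) (auto simp: emeasure_completion)

lemma integrable_bounded_on_cbox:
  fixes g :: "'a::euclidean_space \<Rightarrow> real"
  assumes "g \<in> borel_measurable lebesgue" "AE x in lebesgue. \<bar>g x\<bar> \<le> M * indicator (cbox u v) x"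
  shows "integrable lebesgue g"
proof (rule Bochner_Integration.integrable_bound)
  show "integrable lebesgue (\<lambda>x. M * indicator (cbox u v) x :: real)"
    by (intro integrable_mult_right integrable_indicator_cbox)
  show "AE x in lebesgue. norm (g x) \<le> norm (M * indicator (cbox u v) x :: real)"
    using assms(2) by eventually_elim (auto simp: indicator_def)
qed fact

lemma bump_borel: "bump a b \<in> borel_measurable borel"
  and bump_deriv_borel: "bump_deriv a b \<in> borel_measurable borel"
proof -
  have "continuous_on UNIV (flat_exp p)" for p
    using flat_exp_has_derivative DERIV_isCont continuous_at_imp_continuous_on by blast
  then have [measurable]: "flat_exp p \<in> borel_measurable borel" for p
    by (rule borel_measurable_continuous_onI)
  show "bump a b \<in> borel_measurable borel" "bump_deriv a b \<in> borel_measurable borel"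
    unfolding bump_def bump_deriv_def by measurable
qed

lemma borel_measurable_lebesgue_nth:
  assumes "f \<in> borel_measurable borel"
  shows "(\<lambda>x :: real^'n. f (c * x $ j)) \<in> borel_measurable lebesgue"
proof -
  have "(\<lambda>x :: real^'n. c * x $ j) \<in> borel_measurable borel"
    by (intro borel_measurable_continuous_onI continuous_intros)
  then show ?thesis
    using assms by (intro measurable_completion) (auto intro: measurable_compose)
qed

text \<open>A sharp cutoff in the first coordinate makes the weight increasing in \<open>r\<close>.
  It also allows two-sided comparison with the smooth test function: the inner half-width bounds the
  horizontal bump from below, the full width bounds its derivative from above.\<close>

definition weight :: "real \<Rightarrow> real \<Rightarrow> real^2 \<Rightarrow> real" where
  "weight h r x = indicator {-r..r} (x $ 1) * bump (2 * h) h (x $ 2)"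

lemma weight_nonneg: "0 \<le> weight h r x"
  by (simp add: weight_def bump_bounds)

lemma weight_le: "weight h r x \<le> indicator (cbox (vector [-r, -2 * h]) (vector [r, h])) x"
  using bump_bounds[of "2 * h" h "x $ 2"] bump_eq_0[of "x $ 2" "2 * h" h]
  by (auto simp: weight_def indicator_def mem_box_cart forall_2)

lemma weight_borel: "weight h r \<in> borel_measurable lebesgue"
  using borel_measurable_lebesgue_nth[where f = "indicator {-r..r}" and c = 1 and j = "1::2"]
    borel_measurable_lebesgue_nth[where f = "bump (2*h) h" and c = 1 and j = "2::2", OF bump_borel]
  unfolding weight_def by (auto intro: borel_measurable_times)

lemma integrable_weight: "integrable lebesgue (weight h r)"
  using weight_le weight_nonneg weight_borel
  by (intro integrable_bounded_on_cbox[where M = 1 and u = "vector [-r, -2 * h]" and v = "vector [r, h]"])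
    auto

text \<open>The weight is at most the indicator of a box with sides \<open>2 * r\<close> and
  \<open>3 * h\<close>.\<close>

lemma integral_weight_le:
  assumes "h > 0" "r > 0"
  shows "integral\<^sup>L lebesgue (weight h r) \<le> 6 * h * r"
proof -
  let ?B = "cbox (vector [-r, -2 * h]) (vector [r, h]) :: (real^2) set"
  \<comment> \<open>The product formula for the measure requires a nonempty box.\<close>
  have "0 \<in> ?B" using assms by (auto simp: mem_box_cart forall_2)
  then have "measure lebesgue ?B = 6 * h * r"
    by (subst measure_completion, simp, subst content_cbox_cart) (auto simp: UNIV_2)
  moreover have "integral\<^sup>L lebesgue (weight h r) \<le> integral\<^sup>L lebesgue (indicator ?B)"
    by (intro integral_mono integrable_weight weight_le integrable_indicator_cbox)
  ultimately show ?thesis by simp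
qed

lemma L_infinity_nth_times_integrable:
  fixes \<eta> :: "real^'n \<Rightarrow> real^'n"
  assumes "L_infinity \<eta>" "g \<in> borel_measurable lebesgue"
    and "\<And>x. \<bar>g x\<bar> \<le> M * indicator (cbox u v) x"
  shows "integrable lebesgue (\<lambda>x. \<eta> x $ i * g x)"
proof -
  obtain C where C: "AE x in lebesgue. norm (\<eta> x) \<le> C"
    using assms(1) unfolding L_infinity_def by blast
  have [measurable]: "\<eta> \<in> borel_measurable lebesgue"
    using assms(1) by (simp add: L_infinity_def)
  have [measurable]: "(\<lambda>y :: real^'n. y $ i) \<in> borel_measurable borel"
    by (intro borel_measurable_continuous_onI continuous_intros)
  note assms(2)[measurable]
  have "(\<lambda>x. \<eta> x $ i * g x) \<in> borel_measurable lebesgue"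
    by measurable
  moreover have "AE x in lebesgue. \<bar>\<eta> x $ i * g x\<bar> \<le> C * M * indicator (cbox u v) x"
    using C
  proof eventually_elim
    case (elim x)
    have "\<bar>\<eta> x $ i\<bar> * \<bar>g x\<bar> \<le> C * (M * indicator (cbox u v) x)"
      using elim component_le_norm_cart[of "\<eta> x" i] assms(3)[of x]
      by (intro mult_mono) (auto intro: order_trans[OF norm_ge_zero])
    then show ?case by (simp add: abs_mult mult.assoc)
  qed
  ultimately show ?thesis by (rule integrable_bounded_on_cbox)
qed

lemma weighted_integrable:
  assumes "L_infinity \<eta>"
  shows "integrable lebesgue (\<lambda>x. \<eta> x $ i * weight h r x)"
  using weight_le weight_nonneg
  by (intro L_infinity_nth_times_integrable[OF assms weight_borel,
        where M = 1 and u = "vector [-r, -2 * h]" and v = "vector [r, h]"]) auto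

section \<open>Estimates for the weighted mass of the second component, the \<open>W\<close> of the
  overview\<close>

definition mass :: "(real^2 \<Rightarrow> real^2) \<Rightarrow> real \<Rightarrow> real \<Rightarrow> real" where
  "mass \<eta> h r = (LINT x|lebesgue. \<eta> x $ 2 * weight h r x)"

text \<open>The mass at width \<open>n / 2\<close> appears on the left because the horizontal bump
  is bounded below only on the inner half of its support. The \<open>\<delta>\<close> term does not
  grow with \<open>n\<close>: the factor \<open>1 / n\<close> from differentiating the bump cancels
  the width of the box.\<close>

lemma mass_step:
  fixes \<eta> :: "real^2 \<Rightarrow> real^2"
  assumes L: "L_infinity \<eta>" and div: "distributional_div_zero \<eta>"
    and neg: "AE x in lebesgue. x $ 2 < 0 \<longrightarrow> \<eta> x = 0"
    and nn: "AE x in lebesgue. 0 \<le> \<eta> x $ 2"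
    and bd: "AE x in lebesgue. norm (\<eta> x) \<le> \<delta> + K * \<eta> x $ 2"
    and h: "h > 0" and n: "n > 0" and \<delta>: "\<delta> \<ge> 0"
  shows "3 / (4 * h\<^sup>2) * exp (-4) * mass \<eta> h (n / 2) \<le> 12 * h * \<delta> + 2 * K * (mass \<eta> h n / n)"
proof -
  define G where "G = bump (2 * h) h"
  \<comment> \<open>\<open>d1\<close> and \<open>d2\<close> are the two partial derivatives of the
    test function.\<close>
  define d1 where "d1 x = (1 / n) * bump_deriv 1 1 ((1 / n) * x $ 1) * G (x $ 2)" for x :: "real^2"
  define d2 where "d2 x = bump 1 1 ((1 / n) * x $ 1) * bump_deriv (2 * h) h (x $ 2)" for x :: "real^2"
  define c where "c = 3 / (4 * h\<^sup>2)"
  have c: "c > 0" using h by (simp add: c_def)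
  note [measurable] = borel_measurable_lebesgue_nth[OF bump_borel]
    borel_measurable_lebesgue_nth[OF bump_deriv_borel]
    borel_measurable_lebesgue_nth[where c = 1, OF bump_borel, simplified]
    borel_measurable_lebesgue_nth[where c = 1, OF bump_deriv_borel, simplified]
  have [measurable]: "d1 \<in> borel_measurable lebesgue" "d2 \<in> borel_measurable lebesgue"
    unfolding d1_def d2_def G_def by measurable
  have outside: "(1 / n) * y \<le> -1 \<or> 1 \<le> (1 / n) * y" if "\<bar>y\<bar> > n" for y
    using that n by (auto simp: field_simps abs_if split: if_splits)
  have d1: "\<bar>d1 x\<bar> \<le> 2 / n * weight h n x" for x
  proof (cases "\<bar>x $ 1\<bar> \<le> n")
    case True
    then show ?thesis
      using bump_deriv_bound[of 1 1 "x $ 1 / n"] bump_bounds[of "2 * h" h "x $ 2"] n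
      by (auto simp: d1_def G_def weight_def abs_mult abs_le_iff indicator_def
          intro!: mult_right_mono divide_right_mono)
  next
    case False
    then show ?thesis
      using bump_deriv_eq_0[OF outside] n weight_nonneg by (simp add: d1_def)
  qed
  have int1: "integrable lebesgue (\<lambda>x. \<eta> x $ 1 * d1 x)"
  proof (rule L_infinity_nth_times_integrable[OF L])
    show "\<bar>d1 x\<bar> \<le> 2 / n * indicator (cbox (vector [-n, -2 * h]) (vector [n, h])) x" for x
      using n by (intro order_trans[OF d1] mult_left_mono weight_le) auto
  qed simp
  have int2: "integrable lebesgue (\<lambda>x. \<eta> x $ 2 * d2 x)"
  proof (rule L_infinity_nth_times_integrable[OF L])
    show "\<bar>d2 x\<bar> \<le> 2 * indicator (cbox (vector [-n, -2 * h]) (vector [n, h])) x" for x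
    proof (cases "x \<in> cbox (vector [-n, -2 * h]) (vector [n, h])")
      case True
      have "bump 1 1 ((1 / n) * x $ 1) * \<bar>bump_deriv (2 * h) h (x $ 2)\<bar> \<le> 1 * 2"
        by (intro mult_mono bump_bounds bump_deriv_bound) auto
      with True show ?thesis by (simp add: d2_def abs_mult bump_bounds)
    next
      case False
      then consider "\<bar>x $ 1\<bar> > n" | "x $ 2 \<le> - (2 * h) \<or> h \<le> x $ 2"
        by (auto simp: mem_box_cart forall_2 not_le)
      then have "d2 x = 0"
        by cases (auto simp: d2_def bump_eq_0[OF outside] bump_deriv_eq_0 simp del: times_divide_eq_left)
      with False show ?thesis by simp
    qed
  qed simp
  have "(LINT x|lebesgue. (\<Sum>i\<in>UNIV. \<eta> x $ i * partial_deriv i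
      (\<lambda>x. bump 1 1 ((1 / n) * x $ 1) * bump (2 * h) h (1 * x $ 2)) x)) = 0"
    using div test_function_bump_product[of "1 / n" 1 1 "2 * h" h] n
    unfolding distributional_div_zero_def by fastforce
  then have zero: "(LINT x|lebesgue. \<eta> x $ 1 * d1 x + \<eta> x $ 2 * d2 x) = 0"
    unfolding sum_2 partial_derivs_bump_product d1_def d2_def G_def .
  have "c * exp (-4) * mass \<eta> h (n / 2)
      = (LINT x|lebesgue. c * exp (-4) * (\<eta> x $ 2 * weight h (n / 2) x))"
    by (simp add: mass_def)
  \<comment> \<open>The subtracted pairing of \<open>\<eta>\<close> with the gradient integrates to
    zero; including it turns the claim into a pointwise inequality.\<close>
  also have "\<dots> \<le> (LINT x|lebesgue. 2 / n * (\<delta> * weight h n x + K * (\<eta> x $ 2 * weight h n x))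
      - (\<eta> x $ 1 * d1 x + \<eta> x $ 2 * d2 x))"
  proof (rule integral_mono_AE)
    show "integrable lebesgue (\<lambda>x. 2 / n * (\<delta> * weight h n x + K * (\<eta> x $ 2 * weight h n x))
      - (\<eta> x $ 1 * d1 x + \<eta> x $ 2 * d2 x))"
      by (intro Bochner_Integration.integrable_diff Bochner_Integration.integrable_add
          integrable_mult_right int1 int2 integrable_weight weighted_integrable L)
    show "integrable lebesgue (\<lambda>x. c * exp (-4) * (\<eta> x $ 2 * weight h (n / 2) x))"
      by (intro integrable_mult_right weighted_integrable L)
    show "AE x in lebesgue. c * exp (-4) * (\<eta> x $ 2 * weight h (n / 2) x)
       \<le> 2 / n * (\<delta> * weight h n x + K * (\<eta> x $ 2 * weight h n x))
          - (\<eta> x $ 1 * d1 x + \<eta> x $ 2 * d2 x)"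
      using neg nn bd
    proof eventually_elim
      case (elim x)
      have "\<eta> x $ 1 * d1 x \<le> \<bar>\<eta> x $ 1\<bar> * \<bar>d1 x\<bar>"
        by (metis abs_ge_self abs_mult)
      also have "\<dots> \<le> (\<delta> + K * \<eta> x $ 2) * (2 / n * weight h n x)"
        using elim component_le_norm_cart[of "\<eta> x" 1] by (intro mult_mono d1) auto
      also have "\<dots> = 2 / n * (\<delta> * weight h n x + K * (\<eta> x $ 2 * weight h n x))"
        by (simp only: distrib_left distrib_right mult_ac)
      finally have 1: "\<eta> x $ 1 * d1 x
          \<le> 2 / n * (\<delta> * weight h n x + K * (\<eta> x $ 2 * weight h n x))" .
      have "\<eta> x $ 2 * (c * exp (-4) * weight h (n / 2) x) \<le> \<eta> x $ 2 * - d2 x"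
      \<comment> \<open>The vertical bump need not decrease for negative arguments, but there
        \<open>\<eta>\<close> vanishes.\<close>
      proof (cases "x $ 2 < 0")
        case True
        with elim show ?thesis by simp
      next
        case False
        have 2: "c * G (x $ 2) \<le> - bump_deriv (2 * h) h (x $ 2)"
          using bump_le_neg_deriv[OF h, of "x $ 2"] False by (simp add: c_def G_def)
        have 3: "exp (-4) * indicator {- (n / 2)..n / 2} (x $ 1) \<le> bump 1 1 ((1 / n) * x $ 1)"
        proof (cases "\<bar>x $ 1\<bar> \<le> n / 2")
          case True
          then have "\<bar>(1 / n) * x $ 1\<bar> \<le> 1 / 2"
            using n by (simp add: abs_mult pos_divide_le_eq)
          from bump_ge_half[OF this] True show ?thesis
            by (simp add: indicator_def bump_bounds)
        next
          case False
          then have "x $ 1 \<notin> {- (n / 2)..n / 2}" by auto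
          then show ?thesis by (simp add: bump_bounds)
        qed
        have "0 \<le> c * G (x $ 2)" using c by (simp add: G_def bump_bounds)
        from mult_mono[OF 3 2 bump_bounds(1) this]
        have "c * exp (-4) * weight h (n / 2) x \<le> - d2 x"
          by (simp add: weight_def d2_def G_def mult_ac)
        then show ?thesis using elim(2) by (rule mult_left_mono)
      qed
      moreover have "c * exp (-4) * (\<eta> x $ 2 * weight h (n / 2) x)
          = \<eta> x $ 2 * (c * exp (-4) * weight h (n / 2) x)"
        by (simp only: mult_ac)
      ultimately show ?case using 1 by linarith
    qed
  qed
  \<comment> \<open>The \<open>- 0\<close> stands for the vanishing integral, which is substituted
    back so that linearity finishes the step.\<close>
  also have "\<dots> = 2 / n * (\<delta> * integral\<^sup>L lebesgue (weight h n) + K * mass \<eta> h n) - 0"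
    unfolding zero[symmetric] mass_def
    by (simp add: int1 int2 integrable_weight weighted_integrable L)
  also have "\<dots> \<le> 2 / n * (\<delta> * (6 * h * n) + K * mass \<eta> h n)"
    using integral_weight_le[OF h n] n \<delta>
    by (simp only: diff_zero, intro mult_left_mono add_right_mono) auto
  also have "\<dots> = 12 * h * \<delta> + 2 * K * (mass \<eta> h n / n)"
    using n by (simp add: field_simps)
  finally show ?thesis by (simp add: c_def)
qed

text \<open>The a priori linear growth bound, from \<open>\<eta> x $ 2 \<le> C\<close> and the area
  of the box. It is what makes the right side of \<open>mass_step\<close> bounded in
  \<open>n\<close> at first.\<close>

lemma mass_le:
  assumes "L_infinity \<eta>" "AE x in lebesgue. norm (\<eta> x) \<le> C" "h > 0" "r > 0" "C \<ge> 0"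
  shows "mass \<eta> h r / r \<le> C * (6 * h)"
proof -
  have "mass \<eta> h r \<le> (LINT x|lebesgue. C * weight h r x)"
    unfolding mass_def
  proof (rule integral_mono_AE)
    show "AE x in lebesgue. \<eta> x $ 2 * weight h r x \<le> C * weight h r x"
      using assms(2)
    proof eventually_elim
      case (elim x)
      then show ?case
        using component_le_norm_cart[of "\<eta> x" 2]
        by (intro mult_right_mono weight_nonneg) auto
    qed
  qed (auto intro: weighted_integrable assms integrable_weight)
  also have "\<dots> \<le> C * (6 * h * r)"
    using integral_weight_le[OF assms(3,4)] assms(5) by (simp add: mult_left_mono)
  finally show ?thesis using assms by (simp add: field_simps)
qed

lemma mass_mono:
  assumes "L_infinity \<eta>" "AE x in lebesgue. 0 \<le> \<eta> x $ 2" "r \<le> s"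
  shows "mass \<eta> h r \<le> mass \<eta> h s"
  unfolding mass_def
proof (rule integral_mono_AE)
  show "AE x in lebesgue. \<eta> x $ 2 * weight h r x \<le> \<eta> x $ 2 * weight h s x"
    using assms(2)
    by eventually_elim
      (use assms(3) in \<open>auto intro!: mult_left_mono simp: weight_def indicator_def bump_bounds\<close>)
qed (auto intro: weighted_integrable assms)

lemma mass_nonpos:
  fixes \<eta> :: "real^2 \<Rightarrow> real^2"
  assumes L: "L_infinity \<eta>" and div: "distributional_div_zero \<eta>"
    and neg: "AE x in lebesgue. x $ 2 < 0 \<longrightarrow> \<eta> x = 0"
    and nn: "AE x in lebesgue. 0 \<le> \<eta> x $ 2"
    and bd: "\<And>\<delta>. \<delta> > 0 \<Longrightarrow> \<exists>K\<ge>0. AE x in lebesgue. norm (\<eta> x) \<le> \<delta> + K * \<eta> x $ 2"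
    and h: "h > 0"
  shows "mass \<eta> h r \<le> 0"
proof -
  define c where "c = 3 / (4 * h\<^sup>2) * exp (-4 :: real)"
  have c: "c > 0" using h by (simp add: c_def)
  obtain C where C: "C \<ge> 0" "AE x in lebesgue. norm (\<eta> x) \<le> C"
  proof -
    obtain C where "AE x in lebesgue. norm (\<eta> x) \<le> C"
      using L unfolding L_infinity_def by blast
    \<comment> \<open>Taking the maximum supplies the sign required by
      \<open>mass_le\<close>.\<close>
    then have "AE x in lebesgue. norm (\<eta> x) \<le> max C 0" by eventually_elim simp
    then show ?thesis using that[of "max C 0"] by simp
  qed
  obtain K1 where K1: "K1 \<ge> 0" "AE x in lebesgue. norm (\<eta> x) \<le> 1 + K1 * \<eta> x $ 2"
    using bd[of 1] by auto
  \<comment> \<open>\<open>M\<close> comes from \<open>mass_step\<close> with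
    \<open>\<delta> = 1\<close> and width \<open>2 * n\<close>, the quotient of mass by width being
    bounded by \<open>mass_le\<close>.\<close>
  define M where "M = (12 * h + 2 * K1 * (C * (6 * h))) / c"
  have M: "mass \<eta> h n \<le> M" if "n > 0" for n
  proof -
    have "c * mass \<eta> h n \<le> 12 * h + 2 * K1 * (mass \<eta> h (2 * n) / (2 * n))"
      using mass_step[OF L div neg nn K1(2) h, of "2 * n"] that by (simp add: c_def)
    also have "\<dots> \<le> 12 * h + 2 * K1 * (C * (6 * h))"
      using mass_le[OF L C(2) h _ C(1), of "2 * n"] that K1(1) by (intro add_left_mono mult_left_mono) auto
    finally show ?thesis using c by (simp add: M_def field_simps)
  qed
  have small: "c * mass \<eta> h r \<le> 12 * h * \<delta>" if \<delta>: "\<delta> > 0" for \<delta>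
  proof -
    obtain K where K: "K \<ge> 0" "AE x in lebesgue. norm (\<eta> x) \<le> \<delta> + K * \<eta> x $ 2"
      using bd[OF \<delta>] by auto
    \<comment> \<open>For \<open>n >= 2 * r\<close> monotonicity passes from \<open>r\<close> to
      \<open>n / 2\<close>. The uniform bound \<open>M\<close> now makes the \<open>K\<close> term
      vanish as \<open>n\<close> grows; as \<open>K\<close> depends on \<open>\<delta>\<close>, this
      limit precedes \<open>\<delta> \<rightarrow> 0\<close>.\<close>
    have large: "c * mass \<eta> h r \<le> 12 * h * \<delta> + 2 * K * (M / n)" if "n > 0" "n \<ge> 2 * r" for n
    proof -
      have "c * mass \<eta> h r \<le> c * mass \<eta> h (n / 2)"
        using c that by (intro mult_left_mono mass_mono[OF L nn]) auto
      also have "\<dots> \<le> 12 * h * \<delta> + 2 * K * (mass \<eta> h n / n)"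
        using mass_step[OF L div neg nn K(2) h that(1)] \<delta> by (simp add: c_def)
      also have "\<dots> \<le> 12 * h * \<delta> + 2 * K * (M / n)"
        using M[OF that(1)] that K by (intro add_left_mono mult_left_mono divide_right_mono) auto
      finally show ?thesis .
    qed
    have "\<forall>\<^sub>F n in at_top. c * mass \<eta> h r \<le> 12 * h * \<delta> + 2 * K * (M / n)"
      using eventually_gt_at_top[of 0] eventually_ge_at_top[of "2 * r"]
      by eventually_elim (rule large)
    moreover have "((\<lambda>n. 12 * h * \<delta> + 2 * K * (M / n)) \<longlongrightarrow> 12 * h * \<delta> + 2 * K * 0) at_top"
      by (intro tendsto_intros tendsto_divide_0[OF tendsto_const]
          filterlim_at_top_imp_at_infinity filterlim_ident)
    ultimately have "c * mass \<eta> h r \<le> 12 * h * \<delta> + 2 * K * 0"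
      by (intro tendsto_lowerbound) auto
    then show ?thesis by simp
  qed
  have "c * mass \<eta> h r \<le> 0"
  proof (rule field_le_epsilon)
    fix e :: real assume "e > 0"
    then show "c * mass \<eta> h r \<le> 0 + e"
      using small[of "e / (12 * h)"] h by simp
  qed
  with c show ?thesis by (simp add: mult_le_0_iff)
qed

section \<open>From convexity of \<open>\<phi>\<close> to rigidity\<close>

lemma convex_on_linear_bound:
  fixes \<phi> :: "real \<Rightarrow> real"
  assumes "convex_on {0..} \<phi>" "\<phi> 0 = 0" "\<And>t. t \<ge> 0 \<Longrightarrow> \<phi> t \<ge> 0" "\<delta> > 0" "\<phi> \<delta> > 0" "t \<ge> 0"
  shows "t \<le> \<delta> + \<delta> / \<phi> \<delta> * \<phi> t"
proof (cases "t \<le> \<delta>")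
  case True
  have "0 \<le> \<delta> / \<phi> \<delta> * \<phi> t" using assms by simp
  with True show ?thesis by linarith
next
  case False
  \<comment> \<open>The point \<open>\<delta>\<close> lies between 0 and \<open>t\<close> with
    weight \<open>\<delta> / t\<close>. As \<open>\<phi> 0 = 0\<close>, the slope from the origin at
    \<open>t\<close> is at least the slope at \<open>\<delta>\<close>.\<close>
  have "\<phi> ((1 - \<delta> / t) *\<^sub>R 0 + (\<delta> / t) *\<^sub>R t) \<le> (1 - \<delta> / t) * \<phi> 0 + \<delta> / t * \<phi> t"
    using assms False by (intro convex_onD[OF assms(1)]) auto
  then have "\<phi> \<delta> \<le> \<delta> / t * \<phi> t" using False assms by simp
  then have "t \<le> \<delta> / \<phi> \<delta> * \<phi> t" using False assms by (simp add: field_simps)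
  with assms show ?thesis by linarith
qed

theorem theorem1p3:
  fixes \<phi> :: "real \<Rightarrow> real"
  assumes "\<And>t. t \<ge> 0 \<Longrightarrow> \<phi> t \<ge> 0"
    and "convex_on {0..} \<phi>"
    and "\<And>t. t \<ge> 0 \<Longrightarrow> \<phi> t = 0 \<longleftrightarrow> t = 0"
  shows "phi_rigidity (2::2) \<phi>"
  unfolding phi_rigidity_def
proof (intro allI impI)
  fix \<eta> :: "real^2 \<Rightarrow> real^2"
  assume L: "L_infinity \<eta>" and neg: "AE x in lebesgue. x $ 2 < 0 \<longrightarrow> \<eta> x = 0"
    and div: "distributional_div_zero \<eta>"
    and phi: "AE x in lebesgue. \<phi> (norm (\<eta> x)) \<le> \<eta> x $ 2"
  have nn: "AE x in lebesgue. 0 \<le> \<eta> x $ 2"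
    using phi by eventually_elim (rule order_trans[OF assms(1)[OF norm_ge_zero]])
  have bd: "\<exists>K\<ge>0. AE x in lebesgue. norm (\<eta> x) \<le> \<delta> + K * \<eta> x $ 2" if "\<delta> > 0" for \<delta>
  proof (intro exI conjI)
    have pos: "\<phi> \<delta> > 0"
      using assms(1,3)[of \<delta>] that by (simp add: less_le)
    then show "0 \<le> \<delta> / \<phi> \<delta>" using that by simp
    show "AE x in lebesgue. norm (\<eta> x) \<le> \<delta> + \<delta> / \<phi> \<delta> * \<eta> x $ 2"
      using phi
    proof eventually_elim
      case (elim x)
      have "norm (\<eta> x) \<le> \<delta> + \<delta> / \<phi> \<delta> * \<phi> (norm (\<eta> x))"
        using assms that pos by (intro convex_on_linear_bound) auto
      also have "\<dots> \<le> \<delta> + \<delta> / \<phi> \<delta> * \<eta> x $ 2"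
        using elim that pos by (intro add_left_mono mult_left_mono) auto
      finally show ?case .
    qed
  qed
  have "AE x in lebesgue. \<eta> x $ 2 * weight h h x = 0" if h: "h > 0" for h
  proof -
    have ae: "AE x in lebesgue. 0 \<le> \<eta> x $ 2 * weight h h x"
      using nn by eventually_elim (simp add: weight_nonneg)
    moreover have "mass \<eta> h h = 0"
      using mass_nonpos[OF L div neg nn bd h, of h] integral_nonneg_AE[OF ae]
      by (simp add: mass_def)
    ultimately show ?thesis
      using integral_nonneg_eq_0_iff_AE[OF weighted_integrable[OF L] ae] by (simp add: mass_def)
  qed
  \<comment> \<open>Restricting to \<open>h = r = m + 1\<close> leaves countably many null sets,
    while the sets where these weights are positive still exhaust the plane.\<close>
  then have "AE x in lebesgue. \<forall>m. \<eta> x $ 2 * weight (real (Suc m)) (real (Suc m)) x = 0"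
    by (subst AE_all_countable) simp
  then show "AE x in lebesgue. \<eta> x = 0"
    using neg phi
  proof eventually_elim
    case (elim x)
    show ?case
    proof (cases "x $ 2 < 0")
      case False
      obtain m where m: "\<bar>x $ 1\<bar> + \<bar>x $ 2\<bar> < real m" using reals_Archimedean2 by blast
      have "0 < weight (real (Suc m)) (real (Suc m)) x"
        using m False by (auto simp: weight_def indicator_def intro!: bump_pos)
      with elim(1) have "\<eta> x $ 2 = 0" by (metis mult_eq_0_iff order_less_irrefl)
      \<comment> \<open>Condition (iii) now gives \<open>\<phi> (norm (\<eta> x)) \<le> 0\<close>,
        and \<open>\<phi>\<close> vanishes only at 0.\<close>
      with elim(3) show ?thesis
        using assms(1,3)[of "norm (\<eta> x)"] by simp
    qed (use elim in auto)
  qed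
qed

end
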